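(* Let $0<\varepsilon\le \frac32$, let $\mathcal{P}$ be a family of distributions on $\mathcal{X}$ with real-valued parameter $\theta:\mathcal{P}\to\mathbb{R}$, let $P_0\in\mathcal{P}$, and let $\mathcal{Q}_\varepsilon$ be the collection of all non-interactive $\varepsilon$-differentially private channels. With $L_{\mathrm{sq}}(t)=t^2$, for every $n\in\mathbb{N}$, $$\mathfrak{M}^{\mathrm{loc}}_n(P_0,L_{\mathrm{sq}},\mathcal{P},\mathcal{Q}_\varepsilon)\ \le\ 2\sup_{\tau\ge0}\ \omega_{TV}^2\!\left(\frac{5\sqrt2\,\tau}{\sqrt{n\varepsilon^2}};P_0,\mathcal{P}\right)e^{-\tau^2}.$$
   Context: Data $X_1,\dots,X_n$ are i.i.d. from $P$ on $\mathcal{X}$. A non-interactive channel is a Markov kernel $Q(\cdot\mid x)$ from $\mathcal{X}$ to some $\mathcal{Z}$, with $Z_i\mid X_i=x\sim Q(\cdot\mid x)$ (no dependence on $Z_{1:i-1}$); it is $\varepsilon$-locally differentially private if $Q(A\mid x)\le e^{\varepsilon}Q(A\mid x')$ for all $x,x'\in\mathcal{X}$ and measurable $A$. The local minimax risk is $$\mathfrak{M}^{\mathrm{loc}}_n(P_0,L,\mathcal{P},\mathcal{Q})=\sup_{P_1\in\mathcal{P}}\ \inf_{\hat\theta,\,Q\in\mathcal{Q}}\ \max_{P\in\{P_0,P_1\}}\mathbb{E}_{Q\circ P}\big[L(\hat\theta(Z_1,\dots,Z_n)-\theta(P))\big],$$ where $Q\circ P$ denotes the law of $Z_{1:n}$ when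 $X_i\overset{iid}{\sim}P$ and $Z_i$ are drawn from $Q$, and the infimum is over all estimators $\hat\theta$ of $Z_{1:n}$. The variation modulus is $\omega_{TV}(\delta;P_0,\mathcal{P})=\sup_{P\in\mathcal{P}}\{|\theta(P)-\theta(P_0)|:\|P-P_0\|_{TV}\le\delta\}$, with $\|P-P_0\|_{TV}=\sup_A|P(A)-P_0(A)|$. *)

theory Defs
  imports "HOL-Probability.Probability"
begin

definition tv_dist :: "'x measure \<Rightarrow> 'x measure \<Rightarrow> real" where
  "tv_dist P P' = (SUP A\<in>sets P. \<bar>measure P A - measure P' A\<bar>)"

definition eps_ldp :: "real \<Rightarrow> 'x measure \<Rightarrow> 'z measure \<Rightarrow> ('x \<Rightarrow> 'z measure) \<Rightarrow> bool" where
  "eps_ldp \<epsilon> M N Q \<longleftrightarrow>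
     (\<forall>x\<in>space M. \<forall>x'\<in>space M. \<forall>A\<in>sets N. measure (Q x) A \<le> exp \<epsilon> * measure (Q x') A)"

(* A non-interactive channel out of M is a pair of an output space N and a Markov kernel from
   M to N. The output space is not fixed in advance: it may be any measurable space whose
   points come from the type 'z. *)
definition private_channels :: "real \<Rightarrow> 'x measure \<Rightarrow> ('z measure \<times> ('x \<Rightarrow> 'z measure)) set" where
  "private_channels \<epsilon> M = {(N, Q). Q \<in> M \<rightarrow>\<^sub>M prob_algebra N \<and> eps_ldp \<epsilon> M N Q}"

(* Law of (Z_0, ..., Z_{n-1}): draw X_0, ..., X_{n-1} i.i.d. from P, then, conditionally on
   these, draw the Z_i independently with Z_i distributed as Q (X_i). *)
definition private_law ::
    "nat \<Rightarrow> 'x measure \<Rightarrow> ('x \<Rightarrow> 'z measure) \<Rightarrow> (nat \<Rightarrow> 'z) measure" where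
  "private_law n P Q =
     (\<Pi>\<^sub>M i\<in>{..<n}. P) \<bind> (\<lambda>x. \<Pi>\<^sub>M i\<in>{..<n}. Q (x i))"

definition risk ::
    "nat \<Rightarrow> (real \<Rightarrow> ennreal) \<Rightarrow> ('x measure \<Rightarrow> real) \<Rightarrow> ('x \<Rightarrow> 'z measure) \<Rightarrow>
     ((nat \<Rightarrow> 'z) \<Rightarrow> real) \<Rightarrow> 'x measure \<Rightarrow> ennreal" where
  "risk n L \<theta> Q est P = (\<integral>\<^sup>+z. L (est z - \<theta> P) \<partial>private_law n P Q)"

definition local_minimax_risk ::
    "nat \<Rightarrow> ('x measure \<Rightarrow> real) \<Rightarrow> 'x measure \<Rightarrow> (real \<Rightarrow> ennreal) \<Rightarrow> 'x measure set \<Rightarrow>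
     ('z measure \<times> ('x \<Rightarrow> 'z measure)) set \<Rightarrow> ennreal" where
  "local_minimax_risk n \<theta> P0 L \<P> \<Q> =
     (SUP P1\<in>\<P>. INF (N, Q)\<in>\<Q>. INF est\<in>borel_measurable (\<Pi>\<^sub>M i\<in>{..<n}. N).
        Max (risk n L \<theta> Q est ` {P0, P1}))"

definition sq_loss :: "real \<Rightarrow> ennreal" where
  "sq_loss t = ennreal (t\<^sup>2)"

(* Extended-valued, because the supremum may be infinite. For P0 in the family and
   \<delta> \<ge> 0 it ranges over a set containing P0. *)
definition tv_modulus ::
    "('x measure \<Rightarrow> real) \<Rightarrow> real \<Rightarrow> 'x measure \<Rightarrow> 'x measure set \<Rightarrow> ennreal" where
  "tv_modulus \<theta> \<delta> P0 \<P> = (SUP P\<in>{P\<in>\<P>. tv_dist P P0 \<le> \<delta>}. ennreal \<bar>\<theta> P - \<theta> P0\<bar>)"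

end

theory Submission
  imports Defs
begin

text \<open>
  Two hypotheses \<open>P0\<close> and \<open>P1\<close> are told apart by asking each individual a single binary question and
  privatising the answer. Choose an event \<open>A\<close> whose probabilities under \<open>P1\<close> and \<open>P0\<close> differ by at
  least \<open>3 / 5\<close> of \<open>d = tv_dist P1 P0\<close> (\<open>near_tv_dist_witness\<close>). Each individual reports whether
  \<open>X\<^sub>i \<in> A\<close>, truthfully with probability \<open>exp \<epsilon> / (1 + exp \<epsilon>)\<close> and falsely otherwise. This
  channel is \<open>\<epsilon>\<close>-private (\<open>randomized_response_private\<close>), and it shrinks the difference of the two
  probabilities only by the factor \<open>(exp \<epsilon> - 1) / (exp \<epsilon> + 1)\<close>, which is at least \<open>\<epsilon> / 3\<close> for
  \<open>\<epsilon> \<le> 3 / 2\<close> (\<open>exp_ratio_lower_bound\<close>). The reports are therefore i.i.d. coin tosses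
  (\<open>private_law_eq_PiM\<close>) whose biases under the two hypotheses differ by some \<open>g \<ge> \<epsilon> d / 5\<close>.

  Comparing the number of positive reports with the midpoint of its two expectations selects the
  wrong hypothesis with probability at most \<open>exp (- n g\<^sup>2 / 2)\<close>, by Hoeffding's inequality
  (\<open>PiM_count_deviation\<close>). The estimator that outputs the parameter of the selected hypothesis
  has squared loss \<open>(\<theta> P1 - \<theta> P0)\<^sup>2\<close> when the selection is wrong and \<open>0\<close> otherwise, so
  its risk is at most \<open>(\<theta> P1 - \<theta> P0)\<^sup>2 exp (- n g\<^sup>2 / 2)\<close> (\<open>exists_two_point_estimator\<close>).

  Now let \<open>\<tau>\<close> be the number for which the modulus is taken at \<open>d\<close>, that is
  \<open>\<tau>\<^sup>2 = n \<epsilon>\<^sup>2 d\<^sup>2 / 50\<close>. Then \<open>\<tau>\<^sup>2 \<le> n g\<^sup>2 / 2\<close>, and \<open>\<bar>\<theta> P1 - \<theta> P0\<bar>\<close> is at most the modulus at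
  \<open>d\<close> because \<open>P1\<close> itself competes in it. Hence the risk is bounded by the term of the supremum
  that belongs to \<open>\<tau>\<close>.
\<close>

section \<open>The law of the privatised sample\<close>

lemma emeasure_PiM_kernel_box:
  assumes Q: "Q \<in> M \<rightarrow>\<^sub>M prob_algebra N" and I: "finite I"
    and x: "x \<in> space (\<Pi>\<^sub>M i\<in>I. M)" and F: "\<And>i. i \<in> I \<Longrightarrow> F i \<in> sets N"
  shows "emeasure (\<Pi>\<^sub>M i\<in>I. Q (x i)) (Pi\<^sub>E I F) = (\<Prod>i\<in>I. emeasure (Q (x i)) (F i))"
proof -
  have *: "prob_space (Q (x i)) \<and> sets (Q (x i)) = sets N" if "i \<in> I" for i
    using that x measurable_space[OF Q, of "x i"] by (auto simp: space_PiM space_prob_algebra)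
  then have "prod_emb I (\<lambda>i. Q (x i)) I (Pi\<^sub>E I F) = Pi\<^sub>E I F"
    by (intro prod_emb_PiE_same_index sets.sets_into_space) (auto simp: F)
  then show ?thesis
    using emeasure_PiM_emb[of I "\<lambda>i. Q (x i)" I F] * F I by simp
qed

text \<open>
  The law of the outputs mixes their conditional laws given the data, which can be computed as an
  integral because the conditional law depends measurably on the data. Boxes generate the product
  sigma-algebra, and on a box the dependence is a finite product of measurable functions.
\<close>

lemma prob_kernel_PiM:
  assumes Q: "Q \<in> M \<rightarrow>\<^sub>M prob_algebra N" and I: "finite I"
  shows "(\<lambda>x. \<Pi>\<^sub>M i\<in>I. Q (x i)) \<in> (\<Pi>\<^sub>M i\<in>I. M) \<rightarrow>\<^sub>M prob_algebra (\<Pi>\<^sub>M i\<in>I. N)"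
proof (rule measurable_prob_algebra_generated[OF sets_PiM Int_stable_prod_algebra prod_algebra_sets_into_space])
  fix x assume "x \<in> space (\<Pi>\<^sub>M i\<in>I. M)"
  then have *: "prob_space (Q (x i)) \<and> sets (Q (x i)) = sets N" if "i \<in> I" for i
    using that measurable_space[OF Q, of "x i"] by (auto simp: space_PiM space_prob_algebra)
  then show "prob_space (\<Pi>\<^sub>M i\<in>I. Q (x i))" "sets (\<Pi>\<^sub>M i\<in>I. Q (x i)) = sets (\<Pi>\<^sub>M i\<in>I. N)"
    by (auto intro!: prob_space_PiM sets_PiM_cong)
next
  fix E assume "E \<in> prod_algebra I (\<lambda>i. N)"
  then obtain F where F: "E = Pi\<^sub>E I F" "\<And>i. i \<in> I \<Longrightarrow> F i \<in> sets N"
    by (elim prod_algebraE_all) auto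
  have box: "emeasure (\<Pi>\<^sub>M i\<in>I. Q (x i)) E = (\<Prod>i\<in>I. emeasure (Q (x i)) (F i))"
    if "x \<in> space (\<Pi>\<^sub>M i\<in>I. M)" for x
    unfolding F(1) by (rule emeasure_PiM_kernel_box[OF Q I that F(2)])
  have "(\<lambda>x. \<Prod>i\<in>I. emeasure (Q (x i)) (F i)) \<in> borel_measurable (\<Pi>\<^sub>M i\<in>I. M)"
  proof (rule borel_measurable_prod_ennreal)
    fix i assume i: "i \<in> I"
    have "(\<lambda>x. emeasure (Q x) (F i)) \<in> borel_measurable M"
      using measurable_emeasure_kernel[OF measurable_prob_algebraD[OF Q] F(2)[OF i]] .
    then show "(\<lambda>x. emeasure (Q (x i)) (F i)) \<in> borel_measurable (\<Pi>\<^sub>M i\<in>I. M)"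
      by (rule measurable_compose[OF measurable_component_singleton[OF i]])
  qed
  then show "(\<lambda>x. emeasure (\<Pi>\<^sub>M i\<in>I. Q (x i)) E) \<in> borel_measurable (\<Pi>\<^sub>M i\<in>I. M)"
    by (subst measurable_cong[OF box])
qed

text \<open>
  Since the channel acts on each coordinate separately, Tonelli's theorem factorises the
  probability of a box, and the outputs are again i.i.d.
\<close>

lemma private_law_eq_PiM:
  assumes P: "P \<in> space (prob_algebra M)" and Q: "Q \<in> M \<rightarrow>\<^sub>M prob_algebra N"
  shows "private_law n P Q = (\<Pi>\<^sub>M i\<in>{..<n}. P \<bind> Q)"
proof -
  let ?I = "{..<n}"
  let ?PI = "\<Pi>\<^sub>M i\<in>?I. P" and ?K = "\<lambda>x. \<Pi>\<^sub>M i\<in>?I. Q (x i)"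
  have sets_P: "sets P = sets M" and prob_P: "prob_space P"
    using P by (auto simp: space_prob_algebra)
  have Q_P: "Q \<in> P \<rightarrow>\<^sub>M prob_algebra N"
    using Q by (simp add: sets_P cong: measurable_cong_sets)
  have kernel: "?K \<in> ?PI \<rightarrow>\<^sub>M prob_algebra (\<Pi>\<^sub>M i\<in>?I. N)"
    by (rule prob_kernel_PiM[OF Q_P]) simp
  have prob_PI: "?PI \<in> space (prob_algebra ?PI)"
    by (auto simp: space_prob_algebra intro!: prob_space_PiM prob_P)
  have sets_W: "sets (P \<bind> Q) = sets N"
    by (rule sets_bind'[OF P Q])
  have prob_W: "prob_space (P \<bind> Q)"
    by (rule prob_space_bind'[OF P Q])
  interpret P: prob_space P by (rule prob_P)
  interpret W: prob_space "P \<bind> Q" by (rule prob_W)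
  interpret P: product_prob_space "\<lambda>_. P" ?I by unfold_locales
  interpret W: product_prob_space "\<lambda>_. P \<bind> Q" ?I by unfold_locales
  show ?thesis
    unfolding private_law_def
  proof (rule W.PiM_eqI)
    show "sets (?PI \<bind> ?K) = sets (\<Pi>\<^sub>M i\<in>?I. P \<bind> Q)"
      unfolding sets_bind'[OF prob_PI kernel] by (intro sets_PiM_cong) (auto simp: sets_W)
  next
    fix F assume "\<And>i. i \<in> ?I \<Longrightarrow> F i \<in> sets (P \<bind> Q)"
    then have F: "F i \<in> sets N" if "i \<in> ?I" for i
      using that by (auto simp: sets_W)
    have "emeasure (?PI \<bind> ?K) (Pi\<^sub>E ?I F) = (\<integral>\<^sup>+x. emeasure (?K x) (Pi\<^sub>E ?I F) \<partial>?PI)"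
      using F by (intro emeasure_bind_prob_algebra[OF prob_PI kernel]) auto
    also have "\<dots> = (\<integral>\<^sup>+x. (\<Prod>i\<in>?I. emeasure (Q (x i)) (F i)) \<partial>?PI)"
      using F by (intro nn_integral_cong emeasure_PiM_kernel_box[OF Q_P]) auto
    also have "\<dots> = (\<Prod>i\<in>?I. \<integral>\<^sup>+x. emeasure (Q x) (F i) \<partial>P)"
      using F measurable_emeasure_kernel[OF measurable_prob_algebraD[OF Q_P]]
      by (intro P.product_nn_integral_prod) auto
    also have "\<dots> = (\<Prod>i\<in>?I. emeasure (P \<bind> Q) (F i))"
      using F by (intro prod.cong refl emeasure_bind_prob_algebra[OF P Q, symmetric])
    finally show "emeasure (?PI \<bind> ?K) (Pi\<^sub>E ?I F) = (\<Prod>i\<in>?I. emeasure (P \<bind> Q) (F i))" .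
  qed simp
qed

section \<open>Concentration of the number of positive reports\<close>

text \<open>
  The coordinates of a product measure are independent, because their joint law is that measure
  itself. So Hoeffding's inequality applies to the indicators of \<open>B\<close>, with ranges of length \<open>1\<close>.
\<close>

lemma PiM_count_deviation:
  fixes W :: "'z measure" and s :: real
  assumes W: "prob_space W" and B: "B \<in> sets W" and n: "n \<ge> 1" and s: "s \<ge> 0"
  defines "PW \<equiv> \<Pi>\<^sub>M i\<in>{..<n}. W"
  shows "measure PW {z\<in>space PW. real n * (measure W B + s) \<le> (\<Sum>i<n. indicator B (z i))}
           \<le> exp (- 2 * real n * s\<^sup>2)" (is ?upper)
    and "measure PW {z\<in>space PW. (\<Sum>i<n. indicator B (z i)) \<le> real n * (measure W B - s)}
           \<le> exp (- 2 * real n * s\<^sup>2)" (is ?lower)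
proof -
  interpret W: prob_space W by fact
  interpret PW: prob_space PW
    unfolding PW_def by (rule prob_space_PiM) (rule W)
  have [measurable]: "B \<in> sets W" by (rule B)
  have coord [measurable]: "(\<lambda>z. z i) \<in> PW \<rightarrow>\<^sub>M W" if "i < n" for i
    unfolding PW_def using that by (intro measurable_component_singleton) simp
  have coord_law: "distr PW W (\<lambda>z. z i) = W" if "i < n" for i
    unfolding PW_def using that W by (intro distr_PiM_component) auto
  have "distr PW PW (\<lambda>z. \<lambda>i\<in>{..<n}. z i) = distr PW PW (\<lambda>z. z)"
    by (rule distr_cong) (auto simp: PW_def space_PiM)
  then have "PW.indep_vars (\<lambda>_. W) (\<lambda>i z. z i) {..<n}"
    using n coord_law
    by (subst PW.indep_vars_iff_distr_eq_PiM') (auto simp: PW_def lessThan_empty_iff intro!: PiM_cong)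
  then have indep: "PW.indep_vars (\<lambda>_. borel) (\<lambda>i z. indicator B (z i) :: real) {..<n}"
    by (rule PW.indep_vars_compose2) auto
  have "PW.expectation (\<lambda>z. indicator B (z i)) = measure W B" if "i < n" for i
    using integral_distr[of "\<lambda>z. z i" PW W "indicator B :: _ \<Rightarrow> real"] that
    by (simp add: coord_law W.emeasure_eq_measure)
  then have mean: "real n * measure W B = (\<Sum>i\<in>{..<n}. PW.expectation (\<lambda>z. indicator B (z i)))"
    by simp
  interpret H: Hoeffding_ineq PW "{..<n}" "\<lambda>i z. indicator B (z i)" "\<lambda>_. 0" "\<lambda>_. 1" "real n * measure W B"
  proof unfold_locales
    show "real n * measure W B \<equiv> \<Sum>i\<in>{..<n}. PW.expectation (\<lambda>z. indicator B (z i))"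
      by (rule eq_reflection[OF mean])
  qed (auto intro: indep split: split_indicator)
  have ns: "0 \<le> real n * s" "0 < (\<Sum>i\<in>{..<n}. (1 - 0 :: real)\<^sup>2)"
    "- 2 * (real n * s)\<^sup>2 / (\<Sum>i\<in>{..<n}. (1 - 0)\<^sup>2) = - 2 * real n * s\<^sup>2"
    using s n by (auto simp: power2_eq_square)
  show ?upper ?lower
    using H.Hoeffding_ineq_ge[OF ns(1,2)] H.Hoeffding_ineq_le[OF ns(1,2)]
    unfolding ns(3) by (simp_all add: algebra_simps)
qed

section \<open>Randomized response\<close>

text \<open>
  Warner's randomized response to the question whether \<open>x \<in> A\<close>, with \<open>a\<close> coding the answer
  yes and \<open>b\<close> the answer no. The codes are parameters so that the answers can be points of an
  arbitrary output space.
\<close>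

definition randomized_response :: "real \<Rightarrow> 'x set \<Rightarrow> 'z \<Rightarrow> 'z \<Rightarrow> 'x \<Rightarrow> 'z measure" where
  "randomized_response \<epsilon> A a b x = measure_pmf (map_pmf (\<lambda>c. if c then a else b)
     (bernoulli_pmf (if x \<in> A then exp \<epsilon> / (1 + exp \<epsilon>) else 1 / (1 + exp \<epsilon>))))"

lemma measure_randomized_response:
  "measure (randomized_response \<epsilon> A a b x) B =
     (if x \<in> A then (exp \<epsilon> * indicator B a + indicator B b) / (1 + exp \<epsilon>)
      else (indicator B a + exp \<epsilon> * indicator B b) / (1 + exp \<epsilon>))"
proof -
  have e: "0 < 1 + exp \<epsilon>" by (simp add: add_pos_pos)
  define p where "p = (if x \<in> A then exp \<epsilon> / (1 + exp \<epsilon>) else 1 / (1 + exp \<epsilon>))"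
  have p: "0 \<le> p" "p \<le> 1" using e by (auto simp: p_def)
  have vim: "(\<lambda>c. if c then a else b) -` B = (if a \<in> B then {True} else {}) \<union> (if b \<in> B then {False} else {})"
    by (auto split: if_splits)
  have "measure (bernoulli_pmf p) {True, False} = measure (bernoulli_pmf p) (space (bernoulli_pmf p))"
    by (rule arg_cong[where f = "measure _"]) (auto simp: UNIV_bool)
  then have "measure (bernoulli_pmf p) {True, False} = 1"
    by (simp add: measure_pmf.prob_space)
  then have "measure (randomized_response \<epsilon> A a b x) B = p * indicator B a + (1 - p) * indicator B b"
    using p by (auto simp: randomized_response_def vim measure_pmf_single insert_commute simp flip: p_def)
  then show ?thesis
    using e by (auto simp: p_def field_simps)
qed

lemma randomized_response_measurable:
  assumes "A \<in> sets M"
  shows "randomized_response \<epsilon> A a b \<in> M \<rightarrow>\<^sub>M prob_algebra (count_space UNIV)"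
proof -
  have "randomized_response \<epsilon> A a b = (\<lambda>x. if x \<in> A then
      measure_pmf (map_pmf (\<lambda>c. if c then a else b) (bernoulli_pmf (exp \<epsilon> / (1 + exp \<epsilon>))))
      else measure_pmf (map_pmf (\<lambda>c. if c then a else b) (bernoulli_pmf (1 / (1 + exp \<epsilon>)))))"
    by (auto simp: randomized_response_def fun_eq_iff)
  then show ?thesis
    using assms by (auto intro!: measurable_If_set simp: space_prob_algebra prob_space_measure_pmf)
qed

text \<open>
  Whatever \<open>x\<close> is, each of the two answers has probability \<open>1 / (1 + exp \<epsilon>)\<close> or
  \<open>exp \<epsilon> / (1 + exp \<epsilon>)\<close>. So all output laws lie between the same measure \<open>m\<close> and its multiple
  \<open>exp \<epsilon> * m\<close>.
\<close>

lemma randomized_response_private: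
  assumes A: "A \<in> sets M" and \<epsilon>: "0 \<le> \<epsilon>"
  shows "(count_space UNIV, randomized_response \<epsilon> A a b) \<in> private_channels \<epsilon> M"
proof -
  have e: "1 \<le> exp \<epsilon>" "0 < 1 + exp \<epsilon>" using \<epsilon> by (auto simp: add_pos_pos)
  have "measure (randomized_response \<epsilon> A a b x) B
      \<le> exp \<epsilon> * measure (randomized_response \<epsilon> A a b x') B" for x x' B
  proof -
    define m :: real where "m = (indicator B a + indicator B b) / (1 + exp \<epsilon>)"
    have "measure (randomized_response \<epsilon> A a b x) B \<le> exp \<epsilon> * m"
      using e by (auto simp: m_def measure_randomized_response indicator_def divide_right_mono)
    also have "\<dots> \<le> exp \<epsilon> * measure (randomized_response \<epsilon> A a b x') B"
      using e by (intro mult_left_mono)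
        (auto simp: m_def measure_randomized_response indicator_def divide_right_mono)
    finally show ?thesis .
  qed
  then show ?thesis
    using randomized_response_measurable[OF A] by (auto simp: private_channels_def eps_ldp_def)
qed

lemma measure_bind_randomized_response:
  assumes P: "P \<in> space (prob_algebra M)" and A: "A \<in> sets M" and ab: "a \<noteq> b"
  shows "measure (P \<bind> randomized_response \<epsilon> A a b) {a}
           = (1 + (exp \<epsilon> - 1) * measure P A) / (1 + exp \<epsilon>)"
proof -
  interpret P: prob_space P using P by (simp add: space_prob_algebra)
  have sets_P: "sets P = sets M" using P by (simp add: space_prob_algebra)
  have [measurable]: "A \<in> sets P" using A sets_P by simp
  let ?Q = "randomized_response \<epsilon> A a b"
  have single: "measure (?Q x) {a} = (1 + (exp \<epsilon> - 1) * indicator A x) / (1 + exp \<epsilon>)" for x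
    using ab by (auto simp: measure_randomized_response)
  have "measure (P \<bind> ?Q) {a} = P.expectation (\<lambda>x. measure (?Q x) {a})"
  proof (rule P.measure_bind)
    show "?Q \<in> P \<rightarrow>\<^sub>M subprob_algebra (count_space UNIV)"
      using randomized_response_measurable[of A P] sets_P A by (intro measurable_prob_algebraD) auto
  qed auto
  also have "\<dots> = (1 + (exp \<epsilon> - 1) * measure P A) / (1 + exp \<epsilon>)"
    unfolding single by (simp add: P.prob_space P.emeasure_eq_measure)
  finally show ?thesis .
qed

section \<open>An event that nearly attains the total variation distance\<close>

lemma bdd_above_measure_diff:
  assumes "prob_space P" "prob_space P'"
  shows "bdd_above ((\<lambda>A. \<bar>measure P A - measure P' A\<bar>) ` \<A>)"
proof (rule bdd_aboveI2)
  fix A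
  show "\<bar>measure P A - measure P' A\<bar> \<le> 1"
    using prob_space.prob_le_1[OF assms(1), of A] prob_space.prob_le_1[OF assms(2), of A]
      measure_nonneg[of P A] measure_nonneg[of P' A] by linarith
qed

lemma tv_dist_nonneg:
  assumes "prob_space P" "prob_space P'"
  shows "0 \<le> tv_dist P P'"
  unfolding tv_dist_def
  by (rule cSUP_upper2[OF bdd_above_measure_diff[OF assms] sets.empty_sets]) simp

text \<open>
  Passing to the complement of a set reverses the sign of \<open>P A - P' A\<close>, so the absolute value in
  the total variation distance can be dropped. The constant \<open>c\<close> below \<open>1\<close> replaces the
  maximising set of the Hahn decomposition by a nearly maximising one.
\<close>

lemma near_tv_dist_witness:
  assumes P: "P \<in> space (prob_algebra M)" and P': "P' \<in> space (prob_algebra M)" and c: "c < 1"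
  shows "\<exists>A\<in>sets M. c * tv_dist P P' \<le> measure P A - measure P' A"
proof -
  interpret P: prob_space P using P by (simp add: space_prob_algebra)
  interpret P': prob_space P' using P' by (simp add: space_prob_algebra)
  have sets: "sets P = sets M" "sets P' = sets M"
    using P P' by (auto simp: space_prob_algebra)
  then have space: "space P = space M" "space P' = space M"
    by (auto dest: sets_eq_imp_space_eq)
  show ?thesis
  proof (cases "tv_dist P P' = 0")
    case False
    with tv_dist_nonneg[of P P'] c have "c * tv_dist P P' < tv_dist P P'"
      by (simp add: P.prob_space_axioms P'.prob_space_axioms)
    then have "\<exists>A\<in>sets P. c * tv_dist P P' < \<bar>measure P A - measure P' A\<bar>"
      unfolding tv_dist_def
      by (subst (asm) less_cSUP_iff[OF _ bdd_above_measure_diff])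
        (auto simp: P.prob_space_axioms P'.prob_space_axioms)
    then obtain A where A: "A \<in> sets M" "c * tv_dist P P' < \<bar>measure P A - measure P' A\<bar>"
      using sets by auto
    have compl: "measure P (space M - A) = 1 - measure P A" "measure P' (space M - A) = 1 - measure P' A"
      using P.prob_compl[of A] P'.prob_compl[of A] A sets space by auto
    show ?thesis
    proof (cases "measure P' A \<le> measure P A")
      case True
      with A show ?thesis by (intro bexI[of _ A]) auto
    next
      case False
      with A compl show ?thesis by (intro bexI[of _ "space M - A"]) auto
    qed
  qed (auto intro!: bexI[of _ "{}"])
qed

section \<open>The loss of contrast caused by privacy\<close>

text \<open>
  The ratio is \<open>tanh (\<epsilon> / 2)\<close>. Clearing denominators turns the claim into
  \<open>3 + \<epsilon> \<le> (3 - \<epsilon>) exp \<epsilon>\<close>, for which the quadratic Taylor polynomial of \<open>exp\<close> suffices.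
\<close>

lemma exp_ratio_lower_bound:
  fixes \<epsilon> :: real
  assumes "0 < \<epsilon>" "\<epsilon> \<le> 3 / 2"
  shows "\<epsilon> / 3 \<le> (exp \<epsilon> - 1) / (exp \<epsilon> + 1)"
proof -
  have "1 + \<epsilon> + \<epsilon>\<^sup>2 / 2 \<le> exp \<epsilon>"
    using exp_lower_Taylor_quadratic[of \<epsilon>] assms by simp
  then have "(3 - \<epsilon>) * (1 + \<epsilon> + \<epsilon>\<^sup>2 / 2) \<le> (3 - \<epsilon>) * exp \<epsilon>"
    using assms by (intro mult_left_mono) auto
  moreover have "0 \<le> \<epsilon> * ((2 - \<epsilon>) * (1 + \<epsilon>))"
    using assms by (intro mult_nonneg_nonneg) auto
  moreover have "(3 - \<epsilon>) * (1 + \<epsilon> + \<epsilon>\<^sup>2 / 2) = 3 + \<epsilon> + \<epsilon> * ((2 - \<epsilon>) * (1 + \<epsilon>)) / 2"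
    by (simp add: field_simps power2_eq_square)
  ultimately have "3 + \<epsilon> \<le> (3 - \<epsilon>) * exp \<epsilon>"
    by linarith
  then show ?thesis
    by (simp add: divide_simps algebra_simps add_pos_pos)
qed

section \<open>From testing to estimation\<close>

text \<open>
  The estimator takes only the values \<open>\<theta> P0\<close> and \<open>\<theta> P1\<close>, so its risk is the squared distance of
  these two times the error probability of the underlying test. The test counts the outputs in
  \<open>B\<close> and puts its threshold halfway between the two expected counts. Either error then requires
  a deviation of the relative frequency by \<open>gap / 2\<close>.
\<close>

lemma exists_two_point_estimator:
  fixes \<theta> :: "'x measure \<Rightarrow> real" and N :: "'z measure"
  assumes P0: "P0 \<in> space (prob_algebra M)" and P1: "P1 \<in> space (prob_algebra M)"
    and Q: "Q \<in> M \<rightarrow>\<^sub>M prob_algebra N" and B: "B \<in> sets N" and n: "n \<ge> 1"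
  defines "gap \<equiv> measure (P1 \<bind> Q) B - measure (P0 \<bind> Q) B"
  assumes gap: "gap \<ge> 0"
  shows "\<exists>est\<in>borel_measurable (\<Pi>\<^sub>M i\<in>{..<n}. N). \<forall>P\<in>{P0, P1}.
           risk n sq_loss \<theta> Q est P \<le> ennreal ((\<theta> P1 - \<theta> P0)\<^sup>2 * exp (- real n * gap\<^sup>2 / 2))"
proof -
  define mid where "mid = real n * ((measure (P0 \<bind> Q) B + measure (P1 \<bind> Q) B) / 2)"
  define cnt :: "(nat \<Rightarrow> 'z) \<Rightarrow> real" where "cnt z = (\<Sum>i<n. indicator B (z i))" for z
  define est where "est z = (if mid \<le> cnt z then \<theta> P1 else \<theta> P0)" for z
  define bound where "bound = exp (- real n * gap\<^sup>2 / 2)"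
  have [measurable]: "B \<in> sets N" by (rule B)
  have cnt_N [measurable]: "cnt \<in> borel_measurable (\<Pi>\<^sub>M i\<in>{..<n}. N)"
    unfolding cnt_def by measurable
  have est_N: "est \<in> borel_measurable (\<Pi>\<^sub>M i\<in>{..<n}. N)"
    unfolding est_def by measurable
  have risk_le: "risk n sq_loss \<theta> Q est P \<le> ennreal ((\<theta> P1 - \<theta> P0)\<^sup>2 * bound)"
    if P: "P \<in> space (prob_algebra M)" and PW: "PW = (\<Pi>\<^sub>M i\<in>{..<n}. P \<bind> Q)"
      and wrong: "\<And>z. z \<in> space PW \<Longrightarrow> z \<notin> E \<Longrightarrow> est z = \<theta> P"
      and E: "E \<in> sets PW" and error: "measure PW E \<le> bound" and "P \<in> {P0, P1}" for P PW E
  proof -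
    interpret PW: prob_space PW
      unfolding PW by (rule prob_space_PiM) (rule prob_space_bind'[OF P Q])
    have "risk n sq_loss \<theta> Q est P = (\<integral>\<^sup>+z. sq_loss (est z - \<theta> P) \<partial>PW)"
      by (simp add: risk_def private_law_eq_PiM[OF P Q] PW)
    also have "\<dots> \<le> (\<integral>\<^sup>+z. ennreal ((\<theta> P1 - \<theta> P0)\<^sup>2) * indicator E z \<partial>PW)"
    proof (rule nn_integral_mono)
      fix z assume z: "z \<in> space PW"
      show "sq_loss (est z - \<theta> P) \<le> ennreal ((\<theta> P1 - \<theta> P0)\<^sup>2) * indicator E z"
      proof (cases "z \<in> E")
        case True
        then show ?thesis
          using \<open>P \<in> {P0, P1}\<close> by (auto simp: sq_loss_def est_def power2_commute)
      qed (simp add: sq_loss_def wrong[OF z])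
    qed
    also have "\<dots> = ennreal ((\<theta> P1 - \<theta> P0)\<^sup>2 * measure PW E)"
      using E by (simp add: nn_integral_cmult_indicator PW.emeasure_eq_measure ennreal_mult)
    also have "\<dots> \<le> ennreal ((\<theta> P1 - \<theta> P0)\<^sup>2 * bound)"
      using error by (intro ennreal_leI mult_left_mono) auto
    finally show ?thesis .
  qed
  have exponent: "exp (- 2 * real n * (gap / 2)\<^sup>2) = bound"
    by (simp add: bound_def power_divide)
  have W: "prob_space (P \<bind> Q)" "sets (P \<bind> Q) = sets N" if "P \<in> space (prob_algebra M)" for P
    using prob_space_bind'[OF that Q] sets_bind'[OF that Q] .
  have cnt_W: "cnt \<in> borel_measurable (\<Pi>\<^sub>M i\<in>{..<n}. P \<bind> Q)" if "P \<in> space (prob_algebra M)" for P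
    using cnt_N by (subst measurable_cong_sets[OF sets_PiM_cong refl]) (auto simp: W(2)[OF that])
  have mid: "real n * (measure (P0 \<bind> Q) B + gap / 2) = mid" "real n * (measure (P1 \<bind> Q) B - gap / 2) = mid"
    by (auto simp: mid_def gap_def field_simps)
  let ?PW = "\<lambda>P. \<Pi>\<^sub>M i\<in>{..<n}. P \<bind> Q"
  have "risk n sq_loss \<theta> Q est P0 \<le> ennreal ((\<theta> P1 - \<theta> P0)\<^sup>2 * bound)"
  proof (rule risk_le[OF P0 refl])
    show "measure (?PW P0) {z\<in>space (?PW P0). mid \<le> cnt z} \<le> bound"
      using PiM_count_deviation(1)[OF W(1)[OF P0] _ n, of B "gap / 2"] gap B W(2)[OF P0]
      by (simp only: mid exponent cnt_def)
    show "{z\<in>space (?PW P0). mid \<le> cnt z} \<in> sets (?PW P0)"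
      using cnt_W[OF P0] by measurable
  qed (auto simp: est_def)
  moreover have "risk n sq_loss \<theta> Q est P1 \<le> ennreal ((\<theta> P1 - \<theta> P0)\<^sup>2 * bound)"
  proof (rule risk_le[OF P1 refl])
    show "measure (?PW P1) {z\<in>space (?PW P1). cnt z \<le> mid} \<le> bound"
      using PiM_count_deviation(2)[OF W(1)[OF P1] _ n, of B "gap / 2"] gap B W(2)[OF P1]
      by (simp only: mid exponent cnt_def)
    show "{z\<in>space (?PW P1). cnt z \<le> mid} \<in> sets (?PW P1)"
      using cnt_W[OF P1] by measurable
  qed (auto simp: est_def)
  ultimately show ?thesis
    using est_N by (auto simp: bound_def)
qed

section \<open>The upper bound on the local minimax risk\<close>

(* space (prob_algebra M) is the set of all probability measures on the measurable space M.
   HOL cannot quantify over all output spaces of a channel, only over those carried by a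
   type 'z; the last assumption makes 'z large enough to contain a copy of the reals. *)
theorem corollary2:
  fixes M :: "'x measure"
    and \<P> :: "'x measure set"
    and P0 :: "'x measure"
    and \<theta> :: "'x measure \<Rightarrow> real"
    and \<epsilon> :: real
    and n :: nat
  assumes "0 < \<epsilon>" and "\<epsilon> \<le> 3 / 2"
    and "\<P> \<subseteq> space (prob_algebra M)"
    and "P0 \<in> \<P>"
    and "n \<ge> 1"
    and "\<exists>f :: real \<Rightarrow> 'z. inj f"
  shows "local_minimax_risk n \<theta> P0 sq_loss \<P>
           (private_channels \<epsilon> M :: ('z measure \<times> ('x \<Rightarrow> 'z measure)) set)
         \<le> 2 * (SUP \<tau>\<in>{0::real..}.
                  (tv_modulus \<theta> (5 * sqrt 2 * \<tau> / sqrt (real n * \<epsilon>\<^sup>2)) P0 \<P>)\<^sup>2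
                  * ennreal (exp (- \<tau>\<^sup>2)))"
proof -
  define modulus_bound where "modulus_bound = (SUP \<tau>\<in>{0::real..}.
      (tv_modulus \<theta> (5 * sqrt 2 * \<tau> / sqrt (real n * \<epsilon>\<^sup>2)) P0 \<P>)\<^sup>2 * ennreal (exp (- \<tau>\<^sup>2)))"
  obtain f :: "real \<Rightarrow> 'z" where f: "inj f" using assms(6) by blast
  define a b where "a = f 0" and "b = f 1"
  have ab: "a \<noteq> b" using f by (auto simp: a_def b_def dest: injD)
  have P0: "P0 \<in> space (prob_algebra M)" using assms by auto
  have "(INF (N, Q)\<in>(private_channels \<epsilon> M :: ('z measure \<times> ('x \<Rightarrow> 'z measure)) set).
           INF est\<in>borel_measurable (\<Pi>\<^sub>M i\<in>{..<n}. N). Max (risk n sq_loss \<theta> Q est ` {P0, P1}))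
         \<le> modulus_bound" if "P1 \<in> \<P>" for P1
  proof -
    have P1: "P1 \<in> space (prob_algebra M)" using that assms by auto
    define d where "d = tv_dist P1 P0"
    define \<Delta> where "\<Delta> = \<bar>\<theta> P1 - \<theta> P0\<bar>"
    have d: "0 \<le> d" unfolding d_def using P0 P1 by (simp add: tv_dist_nonneg space_prob_algebra)
    \<comment> \<open>the contrast factor \<open>\<epsilon> / 3\<close> times \<open>3 / 5\<close> is the factor \<open>\<epsilon> / 5\<close> behind the constant \<open>5 sqrt 2\<close>\<close>
    obtain A where A: "A \<in> sets M" "3 / 5 * d \<le> measure P1 A - measure P0 A"
      using near_tv_dist_witness[OF P1 P0, of "3 / 5"] unfolding d_def by auto
    define Q where "Q = randomized_response \<epsilon> A a b"
    define gap where "gap = measure (P1 \<bind> Q) {a} - measure (P0 \<bind> Q) {a}"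
    have channel: "(count_space UNIV, Q) \<in> private_channels \<epsilon> M"
      unfolding Q_def using A assms by (intro randomized_response_private) auto
    have "gap = (exp \<epsilon> - 1) / (exp \<epsilon> + 1) * (measure P1 A - measure P0 A)"
      unfolding gap_def Q_def measure_bind_randomized_response[OF P0 A(1) ab]
        measure_bind_randomized_response[OF P1 A(1) ab]
      by (simp add: add.commute algebra_simps flip: diff_divide_distrib)
    moreover have "\<epsilon> / 3 * (3 / 5 * d) \<le> (exp \<epsilon> - 1) / (exp \<epsilon> + 1) * (measure P1 A - measure P0 A)"
      using exp_ratio_lower_bound[OF assms(1,2)] A(2) d assms(1) by (intro mult_mono) auto
    ultimately have gap: "\<epsilon> * d / 5 \<le> gap" by simp
    moreover have "0 \<le> \<epsilon> * d / 5" using d assms(1) by simp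
    ultimately have gap_nonneg: "0 \<le> gap" and gap_sq: "(\<epsilon> * d / 5)\<^sup>2 \<le> gap\<^sup>2"
      by (auto intro: power_mono)
    obtain est where est: "est \<in> borel_measurable (\<Pi>\<^sub>M i\<in>{..<n}. count_space UNIV)"
      "\<forall>P\<in>{P0, P1}. risk n sq_loss \<theta> Q est P \<le> ennreal ((\<theta> P1 - \<theta> P0)\<^sup>2 * exp (- real n * gap\<^sup>2 / 2))"
      using exists_two_point_estimator[OF P0 P1, of Q "count_space UNIV" "{a}" n \<theta>]
        channel assms(5) gap_nonneg
      unfolding gap_def by (auto simp: private_channels_def)
    \<comment> \<open>solves \<open>5 sqrt 2 \<tau> / sqrt (n \<epsilon>\<^sup>2) = d\<close>, so that the modulus is evaluated at the distance of \<open>P1\<close> and \<open>P0\<close>\<close>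
    define \<tau> where "\<tau> = d * sqrt (real n * \<epsilon>\<^sup>2) / (5 * sqrt 2)"
    have pos: "0 < real n * \<epsilon>\<^sup>2" using assms by simp
    have \<tau>: "0 \<le> \<tau>" "5 * sqrt 2 * \<tau> / sqrt (real n * \<epsilon>\<^sup>2) = d"
      using d pos assms by (auto simp: \<tau>_def)
    have "\<tau>\<^sup>2 = d\<^sup>2 * (real n * \<epsilon>\<^sup>2) / 50"
      using pos by (simp add: \<tau>_def power_divide power_mult_distrib del: real_sqrt_mult)
    also have "\<dots> = real n * (\<epsilon> * d / 5)\<^sup>2 / 2"
      by (simp add: power_divide power_mult_distrib)
    also have "\<dots> \<le> real n * gap\<^sup>2 / 2"
      using gap_sq by (intro divide_right_mono mult_left_mono) auto
    finally have exponent: "exp (- real n * gap\<^sup>2 / 2) \<le> exp (- \<tau>\<^sup>2)" by simp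
    have "ennreal \<Delta> \<le> tv_modulus \<theta> d P0 \<P>"
      unfolding tv_modulus_def \<Delta>_def using that by (intro SUP_upper) (auto simp: d_def)
    then have \<Delta>: "ennreal (\<Delta>\<^sup>2) \<le> (tv_modulus \<theta> d P0 \<P>)\<^sup>2"
      using power_mono[of "ennreal \<Delta>" "tv_modulus \<theta> d P0 \<P>" 2]
      by (simp add: ennreal_power \<Delta>_def)
    have "(INF (N, Q)\<in>(private_channels \<epsilon> M :: ('z measure \<times> ('x \<Rightarrow> 'z measure)) set).
             INF est\<in>borel_measurable (\<Pi>\<^sub>M i\<in>{..<n}. N). Max (risk n sq_loss \<theta> Q est ` {P0, P1}))
           \<le> Max (risk n sq_loss \<theta> Q est ` {P0, P1})"
      by (rule INF_lower2[OF channel]) (use est(1) in \<open>auto intro: INF_lower\<close>)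
    also have "\<dots> \<le> ennreal ((\<theta> P1 - \<theta> P0)\<^sup>2 * exp (- real n * gap\<^sup>2 / 2))"
      using est(2) by simp
    also have "\<dots> \<le> ennreal (\<Delta>\<^sup>2 * exp (- \<tau>\<^sup>2))"
      using exponent by (intro ennreal_leI) (simp add: \<Delta>_def mult_left_mono)
    also have "\<dots> = ennreal (\<Delta>\<^sup>2) * ennreal (exp (- \<tau>\<^sup>2))"
      by (simp add: ennreal_mult)
    also have "\<dots> \<le> (tv_modulus \<theta> d P0 \<P>)\<^sup>2 * ennreal (exp (- \<tau>\<^sup>2))"
      by (intro mult_right_mono \<Delta>) simp
    also have "\<dots> \<le> modulus_bound"
      unfolding modulus_bound_def using \<tau> by (intro SUP_upper2[of \<tau>]) auto
    finally show ?thesis .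
  qed
  then have "local_minimax_risk n \<theta> P0 sq_loss \<P>
      (private_channels \<epsilon> M :: ('z measure \<times> ('x \<Rightarrow> 'z measure)) set) \<le> modulus_bound"
    unfolding local_minimax_risk_def by (rule SUP_least)
  also have "\<dots> \<le> 2 * modulus_bound"
    using mult_right_mono[of 1 2 modulus_bound] by simp
  finally show ?thesis unfolding modulus_bound_def .
qed

end
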